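(* Let $\mathfrak g=A_{3,1}\oplus 2A_1$ and let $G$ be a connected nilpotent Lie group with Lie algebra $\mathfrak g$. Let $T$ be a left-invariant symmetric tensor field of type $(0,2)$ on $G$. There exists a pair $(g,t)$, where $g$ is a left-invariant Riemannian metric on $G$ and $t$ is a non-zero real constant, such that $\mathrm{Ric}(g)=t^2T$, if and only if there is a Milnor basis $\{v_1,\dots,v_5\}$ of $\mathfrak g$ in which $T$ has the form $T=\mathrm{diag}(a,b,0,0,c)$ with real $a,b,c$ satisfying: (1) $a<0$; (2) $a=b=-c$.
   Context: $A_{3,1}\oplus 2A_1$ is the real Lie algebra with basis $\{e_1,\dots,e_5\}$ and only non-zero bracket (up to antisymmetry) $[e_1,e_2]=e_5$. Left-invariant $(0,2)$-tensors on $G$ are identified with bilinear forms on $\mathfrak g$, and the matrix of $T$ in a basis is $(T(v_i,v_j))_{i,j}$. $\mathrm{Ric}(g)$ is the Ricci curvature as a $(0,2)$-tensor. A Milnor basis of $\mathfrak g$ means a basis $\{v_1,\dots,v_5\}$ that is orthonormal with respect to $\eta\langle\cdot,\cdot\rangle$ for some inner product $\langle\cdot,\cdot\rangle$ on $\mathfrak g$ and some $\eta>0$, and such that for some $\alpha>0$ the only non-zero commutator (up to antisymmetry) is $[v_1,v_2]=\alpha v_5$. *)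

theory Defs
  imports "HOL-Analysis.Analysis"
begin

(* Left-invariant vector fields and left-invariant (0,2)-tensors on a connected Lie group are
   represented by vectors of, and bilinear forms on, its Lie algebra (real ^ 'n, br).  The
   Euclidean inner product that the type real ^ 'n carries plays no role here; metrics are
   arbitrary positive definite symmetric bilinear forms. *)

definition lie_bracket :: "(real ^ 'n \<Rightarrow> real ^ 'n \<Rightarrow> real ^ 'n) \<Rightarrow> bool" where
  "lie_bracket br \<longleftrightarrow> bilinear br \<and> (\<forall>x. br x x = 0) \<and>
     (\<forall>x y z. br x (br y z) + br y (br z x) + br z (br x y) = 0)"

definition symmetric_form :: "(real ^ 'n \<Rightarrow> real ^ 'n \<Rightarrow> real) \<Rightarrow> bool" where
  "symmetric_form T \<longleftrightarrow> bilinear T \<and> (\<forall>x y. T x y = T y x)"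

definition inner_product :: "(real ^ 'n \<Rightarrow> real ^ 'n \<Rightarrow> real) \<Rightarrow> bool" where
  "inner_product g \<longleftrightarrow> symmetric_form g \<and> (\<forall>x. x \<noteq> 0 \<longrightarrow> 0 < g x x)"

(* The torsion-free metric connection restricted to left-invariant fields.  Metric
   compatibility reads g (D x y) z + g y (D x z) = 0 because g y z is constant on the group
   for left-invariant y, z. *)
definition is_levi_civita ::
  "(real ^ 'n \<Rightarrow> real ^ 'n \<Rightarrow> real ^ 'n) \<Rightarrow> (real ^ 'n \<Rightarrow> real ^ 'n \<Rightarrow> real) \<Rightarrow>
   (real ^ 'n \<Rightarrow> real ^ 'n \<Rightarrow> real ^ 'n) \<Rightarrow> bool" where
  "is_levi_civita br g D \<longleftrightarrow> bilinear D \<and>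
     (\<forall>x y. D x y - D y x = br x y) \<and>
     (\<forall>x y z. g (D x y) z + g y (D x z) = 0)"

definition levi_civita ::
  "(real ^ 'n \<Rightarrow> real ^ 'n \<Rightarrow> real ^ 'n) \<Rightarrow> (real ^ 'n \<Rightarrow> real ^ 'n \<Rightarrow> real) \<Rightarrow>
   real ^ 'n \<Rightarrow> real ^ 'n \<Rightarrow> real ^ 'n" where
  "levi_civita br g = (THE D. is_levi_civita br g D)"

definition riemann_curvature ::
  "(real ^ 'n \<Rightarrow> real ^ 'n \<Rightarrow> real ^ 'n) \<Rightarrow> (real ^ 'n \<Rightarrow> real ^ 'n \<Rightarrow> real) \<Rightarrow>
   real ^ 'n \<Rightarrow> real ^ 'n \<Rightarrow> real ^ 'n \<Rightarrow> real ^ 'n" where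
  "riemann_curvature br g x y z =
     (let D = levi_civita br g in D x (D y z) - D y (D x z) - D (br x y) z)"

(* The sign convention makes the Ricci tensor of a round sphere positive. *)
definition Ric ::
  "(real ^ 'n \<Rightarrow> real ^ 'n \<Rightarrow> real ^ 'n) \<Rightarrow> (real ^ 'n \<Rightarrow> real ^ 'n \<Rightarrow> real) \<Rightarrow>
   real ^ 'n \<Rightarrow> real ^ 'n \<Rightarrow> real" where
  "Ric br g y z = trace (matrix (\<lambda>x. riemann_curvature br g x y z))"

definition form_matrix ::
  "('a \<Rightarrow> 'a \<Rightarrow> real) \<Rightarrow> ('n \<Rightarrow> 'a) \<Rightarrow> real ^ 'n ^ 'n" where
  "form_matrix T v = (\<chi> i j. T (v i) (v j))"

definition diag :: "real ^ 'n \<Rightarrow> real ^ 'n ^ 'n" where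
  "diag d = (\<chi> i j. if i = j then d $ i else 0)"

(* A_{3,1} + 2 A_1 with e_i = axis i 1.  In the index type 5 the numeral 5 denotes 0, so the
   five indices 1, ..., 5 are distinct. *)
definition heis_bracket :: "real ^ 5 \<Rightarrow> real ^ 5 \<Rightarrow> real ^ 5" where
  "heis_bracket x y = (x $ 1 * y $ 2 - x $ 2 * y $ 1) *\<^sub>R axis 5 1"

definition milnor_basis :: "(5 \<Rightarrow> real ^ 5) \<Rightarrow> bool" where
  "milnor_basis v \<longleftrightarrow>
     inj v \<and> independent (range v) \<and> span (range v) = UNIV \<and>
     (\<exists>h \<eta>. inner_product h \<and> \<eta> > 0 \<and> (\<forall>i j. \<eta> * h (v i) (v j) = (if i = j then 1 else 0))) \<and>
     (\<exists>\<alpha>>0. \<forall>i j. heis_bracket (v i) (v j) =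
        (if i = 1 \<and> j = 2 then \<alpha> *\<^sub>R v 5
         else if i = 2 \<and> j = 1 then - (\<alpha> *\<^sub>R v 5) else 0))"

lemma exhaust_5: "x = 1 \<or> x = 2 \<or> x = 3 \<or> x = 4 \<or> x = 5" for x :: 5
proof (induct x)
  case (of_int z)
  then have "0 \<le> z" and "z < 5" by simp_all
  then have "z = 0 \<or> z = 1 \<or> z = 2 \<or> z = 3 \<or> z = 4" by arith
  then show ?case by auto
qed

lemma forall_5: "(\<forall>i::5. P i) \<longleftrightarrow> P 1 \<and> P 2 \<and> P 3 \<and> P 4 \<and> P 5"
  by (metis exhaust_5)

lemma vector_5 [simp]:
  "(vector [a, b, c, d, e] :: real ^ 5) $ 1 = a"
  "(vector [a, b, c, d, e] :: real ^ 5) $ 2 = b"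
  "(vector [a, b, c, d, e] :: real ^ 5) $ 3 = c"
  "(vector [a, b, c, d, e] :: real ^ 5) $ 4 = d"
  "(vector [a, b, c, d, e] :: real ^ 5) $ 5 = e"
  unfolding vector_def by simp_all

lemma lie_bracket_heis: "lie_bracket heis_bracket"
  unfolding lie_bracket_def bilinear_def heis_bracket_def
  by (auto intro!: linearI simp: algebra_simps axis_def vec_eq_iff)

lemma heis_bracket_axis:
  "heis_bracket (axis i 1) (axis j 1) =
     (if i = 1 \<and> j = 2 then axis 5 1 else if i = 2 \<and> j = 1 then - axis 5 1 else 0)"
  using exhaust_5[of i] exhaust_5[of j] unfolding heis_bracket_def by (auto simp: axis_def)

lemma inner_product_eqI:
  assumes g: "inner_product g" and eq: "\<And>z. g x z = g y z"
  shows "x = y"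
proof -
  have b: "bilinear g" using g by (simp add: inner_product_def symmetric_form_def)
  have "g (x - y) (x - y) = 0" by (simp add: bilinear_lsub[OF b] eq)
  then have "x - y = 0" using g unfolding inner_product_def by (metis less_irrefl)
  then show ?thesis by simp
qed

lemma inner_product_represents:
  fixes g :: "real ^ 'n \<Rightarrow> real ^ 'n \<Rightarrow> real"
  assumes g: "inner_product g" and f: "linear f"
  shows "\<exists>w. \<forall>z. g w z = f z"
proof -
  have b: "bilinear g" using g by (simp add: inner_product_def symmetric_form_def)
  have l2: "linear (g x)" for x using b by (simp add: bilinear_def)
  define F where "F x = (\<chi> i. g x (axis i 1))" for x
  have "linear F"
    unfolding F_def by (rule linearI) (simp_all add: vec_eq_iff bilinear_ladd[OF b] bilinear_lmul[OF b])
  have det: "h = k" if "linear h" "linear k" "\<And>i. h (axis i 1) = k (axis i 1)"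
    for h k :: "real ^ 'n \<Rightarrow> real"
    using that by (intro linear_eq_stdbasis) (auto simp: Basis_vec_def)
  have "inj F"
  proof (rule injI)
    fix x y assume "F x = F y"
    then have "g x = g y" by (intro det l2) (simp add: F_def vec_eq_iff)
    then show "x = y" by (intro inner_product_eqI[OF g]) simp
  qed
  then have "surj F" using \<open>linear F\<close> linear_injective_imp_surjective by blast
  then obtain w where "F w = (\<chi> i. f (axis i 1))" by (metis surjD)
  then have "g w = f" by (intro det l2 f) (simp add: F_def vec_eq_iff)
  then show ?thesis by auto
qed

lemma koszul:
  assumes g: "inner_product g" and D: "is_levi_civita br g D"
  shows "2 * g (D x y) z = g (br x y) z - g (br y z) x + g (br z x) y"
proof -
  have b: "bilinear g" and s: "\<And>x y. g x y = g y x"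
    using g by (auto simp: inner_product_def symmetric_form_def)
  have t: "br x y = D x y - D y x" and m: "g (D x y) z = - g (D x z) y" for x y z
    using D s unfolding is_levi_civita_def by (auto simp: eq_neg_iff_add_eq_0)
  show ?thesis
    using m[of x y z] m[of y z x] m[of z x y] unfolding t by (simp add: bilinear_lsub[OF b])
qed

lemma ex1_levi_civita:
  fixes br :: "real ^ 'n \<Rightarrow> real ^ 'n \<Rightarrow> real ^ 'n"
  assumes br: "lie_bracket br" and g: "inner_product g"
  shows "\<exists>!D. is_levi_civita br g D"
proof (rule ex_ex1I)
  have b: "bilinear g" and s: "\<And>x y. g x y = g y x"
    using g by (auto simp: inner_product_def symmetric_form_def)
  have bb: "bilinear br" and b0: "\<And>x. br x x = 0"
    using br by (auto simp: lie_bracket_def)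
  have anti: "br x y = - br y x" for x y
  proof -
    have "br x x + br x y + (br y x + br y y) = 0"
      using b0[of "x + y"] unfolding bilinear_ladd[OF bb] bilinear_radd[OF bb]
      by (simp only: ac_simps)
    then show ?thesis by (simp add: b0 eq_neg_iff_add_eq_0)
  qed
  note bs = bilinear_ladd[OF b] bilinear_radd[OF b] bilinear_lmul[OF b] bilinear_rmul[OF b]
    bilinear_ladd[OF bb] bilinear_radd[OF bb] bilinear_lmul[OF bb] bilinear_rmul[OF bb]
    bilinear_lneg[OF b] bilinear_lsub[OF b]
  define K where "K x y z = (g (br x y) z - g (br y z) x + g (br z x) y) / 2" for x y z
  have lK: "linear (K x y)" for x y
    by (rule linearI) (simp_all add: K_def bs field_simps)
  define D where "D x y = (SOME w. \<forall>z. g w z = K x y z)" for x y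
  have D: "g (D x y) z = K x y z" for x y z
    unfolding D_def using someI_ex[OF inner_product_represents[OF g lK[of x y]]] by blast
  have "D x (y + z) = D x y + D x z" "D (x + y) z = D x z + D y z"
    "D x (c *\<^sub>R y) = c *\<^sub>R D x y" "D (c *\<^sub>R x) y = c *\<^sub>R D x y" for x y z c
  proof -
    show "D x (y + z) = D x y + D x z"
      by (rule inner_product_eqI[OF g]) (simp add: D K_def bs add_divide_distrib diff_divide_distrib)
    show "D (x + y) z = D x z + D y z"
      by (rule inner_product_eqI[OF g]) (simp add: D K_def bs add_divide_distrib diff_divide_distrib)
    show "D x (c *\<^sub>R y) = c *\<^sub>R D x y"
      by (rule inner_product_eqI[OF g]) (simp add: D K_def bs algebra_simps)
    show "D (c *\<^sub>R x) y = c *\<^sub>R D x y"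
      by (rule inner_product_eqI[OF g]) (simp add: D K_def bs algebra_simps)
  qed
  then have "bilinear D"
    unfolding bilinear_def by (blast intro: linearI)
  moreover have "D x y - D y x = br x y" for x y
  proof (rule inner_product_eqI[OF g])
    fix z show "g (D x y - D y x) z = g (br x y) z"
      by (simp only: bilinear_lsub[OF b] D K_def anti[of y x] anti[of z x] anti[of z y] bilinear_lneg[OF b]) (simp add: field_simps)
  qed
  moreover have "g (D x y) z + g y (D x z) = 0" for x y z
  proof -
    have "g (D x y) z + g y (D x z) = K x y z + K x z y" by (simp only: s[of y] D)
    also have "\<dots> = 0"
      unfolding K_def anti[of y x] anti[of z x] anti[of z y] bilinear_lneg[OF b] by (simp add: field_simps)
    finally show ?thesis .
  qed
  ultimately show "\<exists>D. is_levi_civita br g D" unfolding is_levi_civita_def by blast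
next
  fix D E assume D: "is_levi_civita br g D" and E: "is_levi_civita br g E"
  have "2 * g (D x y) z = 2 * g (E x y) z" for x y z
    using koszul[OF g D, of x y z] koszul[OF g E, of x y z] by linarith
  then show "D = E" by (intro ext inner_product_eqI[OF g]) simp
qed

end

theory Submission
  imports Defs
begin

text \<open>
  Every inner product on the algebra admits an orthonormal frame with single bracket
  \<open>[v\<^sub>1, v\<^sub>2] = \<alpha> v\<^sub>5\<close>, \<open>\<alpha> > 0\<close>
  (\<open>exists_orthonormal_milnor_frame\<close>): apply Gram--Schmidt to
  \<open>e\<^sub>5, e\<^sub>4, e\<^sub>3, e\<^sub>2, e\<^sub>1\<close>, that is, along the flag that
  passes through the derived algebra and the centre. In such a frame the Koszul formula gives the
  Levi-Civita connection explicitly, and the trace of the curvature is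
  \<open>Ric = (\<alpha>\<^sup>2 / 2) diag (-1, -1, 0, 0, 1)\<close> (\<open>Ric_milnor\<close>).

  Hence the Ricci tensor of any metric has the shape \<open>diag (-c, -c, 0, 0, c)\<close> with
  \<open>c > 0\<close> in a Milnor basis, and dividing by \<open>t\<^sup>2\<close> keeps this shape.
  Conversely, if \<open>T\<close> has it in a Milnor basis \<open>v\<close>, the metric making \<open>v\<close>
  orthonormal has a Ricci tensor that is a positive multiple of \<open>T\<close>, and a positive number
  is a square.
\<close>

section \<open>Orthonormal frames of an arbitrary inner product\<close>

definition orthonormal_frame ::
  "(real ^ 'n \<Rightarrow> real ^ 'n \<Rightarrow> real) \<Rightarrow> ('n \<Rightarrow> real ^ 'n) \<Rightarrow> bool" where
  "orthonormal_frame g v \<longleftrightarrow> (\<forall>i j. g (v i) (v j) = (if i = j then 1 else 0))"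

lemma inner_product_bilinear: "inner_product g \<Longrightarrow> bilinear g"
  by (simp add: inner_product_def symmetric_form_def)

lemma inner_product_commute: "inner_product g \<Longrightarrow> g x y = g y x"
  by (simp add: inner_product_def symmetric_form_def)

lemmas bilinear_expand = bilinear_ladd bilinear_radd bilinear_lsub
  bilinear_lmul bilinear_rmul

lemma bilinear_sum_left: "bilinear h \<Longrightarrow> h (\<Sum>i\<in>I. f i) y = (\<Sum>i\<in>I. h (f i) y)"
  unfolding bilinear_def using linear_sum[of "\<lambda>x. h x y"] by blast

lemma bilinear_sum_right: "bilinear h \<Longrightarrow> h x (\<Sum>i\<in>I. f i) = (\<Sum>i\<in>I. h x (f i))"
  unfolding bilinear_def using linear_sum[of "h x"] by blast

lemma orthonormal_frame_basis:
  fixes g :: "real ^ 'n \<Rightarrow> real ^ 'n \<Rightarrow> real"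
  assumes g: "inner_product g" and v: "orthonormal_frame g v"
  shows "inj v" and "independent (range v)" and "span (range v) = UNIV"
proof -
  note b = inner_product_bilinear[OF g]
  have e: "g (v i) (v j) = (if i = j then 1 else 0)" for i j
    using v by (simp add: orthonormal_frame_def)
  show inj: "inj v"
    by (metis e injI zero_neq_one)
  show ind: "independent (range v)"
  proof (rule independent_if_scalars_zero)
    fix f x assume s: "(\<Sum>w\<in>range v. f w *\<^sub>R w) = 0" and "x \<in> range v"
    then obtain k where k: "x = v k" by blast
    have "0 = g (\<Sum>i\<in>UNIV. f (v i) *\<^sub>R v i) (v k)"
      using s by (simp add: sum.reindex[OF inj] bilinear_lzero[OF b])
    also have "\<dots> = (\<Sum>i\<in>UNIV. if i = k then f (v k) else 0)"
      by (simp add: bilinear_sum_left[OF b] bilinear_lmul[OF b] e if_distrib cong: if_cong)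
    finally show "f x = 0" by (simp add: k)
  qed simp
  have "dim (range v) = DIM(real ^ 'n)"
    by (simp add: dim_eq_card_independent[OF ind] card_image[OF inj])
  then show "span (range v) = UNIV"
    by (rule dim_eq_full[THEN iffD1])
qed

text \<open>Both sides are linear in \<open>x\<close> and agree on the frame, which spans.\<close>
lemma orthonormal_frame_expansion:
  fixes g :: "real ^ 'n \<Rightarrow> real ^ 'n \<Rightarrow> real"
  assumes g: "inner_product g" and v: "orthonormal_frame g v"
  shows "(\<Sum>i\<in>UNIV. g x (v i) *\<^sub>R v i) = x"
proof -
  note b = inner_product_bilinear[OF g]
  define F where "F x = (\<Sum>i\<in>UNIV. g x (v i) *\<^sub>R v i)" for x
  have "linear F"
    unfolding F_def
    by (rule linearI)
      (simp_all add: bilinear_expand[OF b] scaleR_add_left sum.distrib scaleR_sum_right)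
  moreover have "F w = w" if w: "w \<in> range v" for w
  proof -
    obtain k where k: "w = v k" using w by blast
    have "F w = (\<Sum>i\<in>UNIV. if k = i then v i else 0)"
      unfolding F_def k by (intro sum.cong) (use v in \<open>auto simp: orthonormal_frame_def\<close>)
    then show ?thesis by (simp add: k)
  qed
  ultimately have "F x = x"
    using linear_eq_on[of F id x "range v"] orthonormal_frame_basis(3)[OF g v] linear_id by simp
  then show ?thesis by (simp add: F_def)
qed

lemma bilinear_frame_expansion:
  fixes g :: "real ^ 'n \<Rightarrow> real ^ 'n \<Rightarrow> real" and h :: "_ \<Rightarrow> _ \<Rightarrow> 'b::real_vector"
  assumes g: "inner_product g" and v: "orthonormal_frame g v" and h: "bilinear h"
  shows "h x y = (\<Sum>i\<in>UNIV. \<Sum>j\<in>UNIV. (g x (v i) * g y (v j)) *\<^sub>R h (v i) (v j))"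
proof -
  have "h x y = h (\<Sum>i\<in>UNIV. g x (v i) *\<^sub>R v i) (\<Sum>j\<in>UNIV. g y (v j) *\<^sub>R v j)"
    by (simp only: orthonormal_frame_expansion[OF g v])
  also have "\<dots> = (\<Sum>i\<in>UNIV. \<Sum>j\<in>UNIV. (g x (v i) * g y (v j)) *\<^sub>R h (v i) (v j))"
    unfolding bilinear_sum_left[OF h]
    by (simp add: bilinear_sum_right[OF h] bilinear_lmul[OF h] bilinear_rmul[OF h]
        mult.commute)
  finally show ?thesis .
qed

text \<open>Each standard basis vector is expanded in the frame; exchanging the two sums reassembles
  \<open>f (v i)\<close> from its standard coordinates.\<close>
lemma trace_orthonormal_frame:
  fixes g :: "real ^ 'n \<Rightarrow> real ^ 'n \<Rightarrow> real"
  assumes g: "inner_product g" and v: "orthonormal_frame g v" and f: "linear f"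
  shows "trace (matrix f) = (\<Sum>i\<in>UNIV. g (f (v i)) (v i))"
proof -
  note b = inner_product_bilinear[OF g]
  have E: "(\<Sum>k\<in>UNIV. w $ k *\<^sub>R axis k 1) = w" for w :: "real ^ 'n"
    using basis_expansion[of w] by (simp add: scalar_mult_eq_scaleR)
  have "f (axis k 1) $ k = (\<Sum>i\<in>UNIV. g (axis k 1) (v i) * f (v i) $ k)" for k
  proof -
    have "f (axis k 1) = f (\<Sum>i\<in>UNIV. g (axis k 1) (v i) *\<^sub>R v i)"
      by (simp only: orthonormal_frame_expansion[OF g v])
    then show ?thesis by (simp add: linear_sum[OF f] linear_cmul[OF f])
  qed
  then have "trace (matrix f) = (\<Sum>k\<in>UNIV. \<Sum>i\<in>UNIV. g (axis k 1) (v i) * f (v i) $ k)"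
    by (simp add: trace_def matrix_def)
  also have "\<dots> = (\<Sum>i\<in>UNIV. \<Sum>k\<in>UNIV. g (f (v i) $ k *\<^sub>R axis k 1) (v i))"
    by (subst sum.swap) (simp add: bilinear_lmul[OF b] mult.commute)
  also have "\<dots> = (\<Sum>i\<in>UNIV. g (f (v i)) (v i))"
    by (simp only: E bilinear_sum_left[OF b, symmetric])
  finally show ?thesis .
qed

text \<open>One step of the Gram--Schmidt process: the residual of \<open>x\<close> modulo its projection to
  \<open>span B\<close>, normalised.\<close>
lemma gram_schmidt_step:
  assumes g: "inner_product g" and "finite B"
    and o: "\<And>b c. b \<in> B \<Longrightarrow> c \<in> B \<Longrightarrow> g b c = (if b = c then 1 else 0)"
    and x: "x \<notin> span B"
  obtains u c where "c > 0" "u - c *\<^sub>R x \<in> span B" "g u u = 1" "\<And>b. b \<in> B \<Longrightarrow> g u b = 0"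
proof -
  note b = inner_product_bilinear[OF g]
  define p where "p = (\<Sum>b\<in>B. g x b *\<^sub>R b)"
  have p: "p \<in> span B" unfolding p_def by (intro span_sum span_scale span_base)
  have "x - p \<noteq> 0" using x p by auto
  then have pos: "0 < g (x - p) (x - p)" using g by (simp add: inner_product_def)
  have orth: "g (x - p) w = 0" if w: "w \<in> B" for w
  proof -
    have "g p w = (\<Sum>b\<in>B. if b = w then g x w else 0)"
      unfolding p_def bilinear_sum_left[OF b]
      by (intro sum.cong) (auto simp: bilinear_lmul[OF b] o w)
    then show ?thesis using \<open>finite B\<close> w by (simp add: bilinear_lsub[OF b])
  qed
  define c where "c = 1 / sqrt (g (x - p) (x - p))"
  have "c > 0" using pos by (simp add: c_def)
  moreover have "c *\<^sub>R (x - p) - c *\<^sub>R x \<in> span B"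
    using span_neg[OF span_scale[OF p, of c]] by (simp add: scaleR_diff_right)
  moreover have "g (c *\<^sub>R (x - p)) (c *\<^sub>R (x - p)) = 1"
    using pos by (simp add: bilinear_lmul[OF b] bilinear_rmul[OF b] c_def)
  moreover have "g (c *\<^sub>R (x - p)) w = 0" if "w \<in> B" for w
    using orth[OF that] by (simp add: bilinear_lmul[OF b])
  ultimately show thesis by (rule that)
qed

text \<open>In the step that adds \<open>axis k 1\<close>, the new vector differs from a positive multiple of it by
  an element of \<open>span B\<close>. So every coordinate other than \<open>k\<close> that vanishes on \<open>B\<close> still
  vanishes on the new vector: this is the triangularity that controls brackets below.\<close>
lemma gram_schmidt_step_axis:
  fixes g :: "real ^ 'n \<Rightarrow> real ^ 'n \<Rightarrow> real"
  assumes g: "inner_product g" and "finite B"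
    and o: "\<And>b c. b \<in> B \<Longrightarrow> c \<in> B \<Longrightarrow> g b c = (if b = c then 1 else 0)"
    and k: "\<And>b. b \<in> B \<Longrightarrow> b $ k = 0"
  obtains u where "u $ k > 0" "g u u = 1" "\<forall>b\<in>B. g u b = 0"
    "\<forall>j. j \<noteq> k \<longrightarrow> (\<forall>b\<in>B. b $ j = 0) \<longrightarrow> u $ j = 0"
proof -
  have co: "w $ j = 0" if "w \<in> span B" "\<And>b. b \<in> B \<Longrightarrow> b $ j = 0" for w j
    using that(1) by (induction rule: span_induct_alt) (simp_all add: that(2))
  have "axis k 1 \<notin> span B"
    using co[OF _ k, of "axis k 1"] by (auto simp: axis_def)
  from gram_schmidt_step[OF g \<open>finite B\<close> o this] obtain u c where
    u: "c > 0" "u - c *\<^sub>R axis k 1 \<in> span B" "g u u = 1" "\<And>b. b \<in> B \<Longrightarrow> g u b = 0" by metis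
  show thesis
  proof (rule that)
    show "u $ k > 0" using co[OF u(2) k] u(1) by (simp add: axis_def)
    show "\<forall>j. j \<noteq> k \<longrightarrow> (\<forall>b\<in>B. b $ j = 0) \<longrightarrow> u $ j = 0"
    proof (intro allI impI)
      fix j assume "j \<noteq> k" "\<forall>b\<in>B. b $ j = 0"
      then show "u $ j = 0" using co[OF u(2), of j] by (simp add: axis_def)
    qed
  qed (use u in auto)
qed

section \<open>Milnor frames\<close>

lemma sum_UNIV_5: "(\<Sum>i\<in>UNIV. f i) = f 1 + f 2 + f 3 + f 4 + f (5::5)"
  for f :: "5 \<Rightarrow> 'a::comm_monoid_add"
proof -
  have "UNIV = {1, 2, 3, 4, 5::5}" using exhaust_5 by auto
  then have "sum f UNIV = sum f {1, 2, 3, 4, 5}" by (simp only:)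
  also have "\<dots> = f 1 + f 2 + f 3 + f 4 + f 5" by (simp add: add.assoc)
  finally show ?thesis .
qed

definition milnor_bracket :: "real \<Rightarrow> (5 \<Rightarrow> real ^ 5) \<Rightarrow> bool" where
  "milnor_bracket \<alpha> v \<longleftrightarrow> (\<forall>i j. heis_bracket (v i) (v j) =
     (if i = 1 \<and> j = 2 then \<alpha> *\<^sub>R v 5
      else if i = 2 \<and> j = 1 then - (\<alpha> *\<^sub>R v 5) else 0))"

text \<open>Starting from the centre makes \<open>v\<^sub>3, v\<^sub>4, v\<^sub>5\<close> central and \<open>v\<^sub>5\<close> a multiple of
  \<open>e\<^sub>5\<close>, so only \<open>[v\<^sub>1, v\<^sub>2]\<close> survives. Triangularity reduces it to the product of
  two diagonal coefficients, and since Gram--Schmidt makes these positive, so is \<open>\<alpha>\<close>.\<close>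
lemma exists_orthonormal_milnor_frame:
  assumes g: "inner_product g"
  obtains v \<alpha> where "orthonormal_frame g v" "\<alpha> > 0" "milnor_bracket \<alpha> v"
proof -
  note s = inner_product_commute[OF g]
  obtain v5 where v5: "v5 $ 5 > 0" "g v5 v5 = 1" "\<And>j. j \<noteq> 5 \<Longrightarrow> v5 $ j = 0"
    by (rule gram_schmidt_step_axis[OF g, of "{}" 5]) auto
  obtain v4 where v4: "g v4 v4 = 1" "g v4 v5 = 0" "v4 $ 1 = 0" "v4 $ 2 = 0" "v4 $ 3 = 0"
    by (rule gram_schmidt_step_axis[OF g, of "{v5}" 4]) (auto simp: v5)
  obtain v3 where v3: "g v3 v3 = 1" "g v3 v5 = 0" "g v3 v4 = 0" "v3 $ 1 = 0" "v3 $ 2 = 0"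
    by (rule gram_schmidt_step_axis[OF g, of "{v5, v4}" 3])
      (auto simp: v5 v4 s[of v5 v4])
  obtain v2 where v2: "v2 $ 2 > 0" "g v2 v2 = 1" "g v2 v5 = 0" "g v2 v4 = 0" "g v2 v3 = 0"
    "v2 $ 1 = 0"
    by (rule gram_schmidt_step_axis[OF g, of "{v5, v4, v3}" 2])
      (auto simp: v5 v4 v3 s[of v5 v4] s[of v5 v3] s[of v4 v3])
  obtain v1 where v1: "v1 $ 1 > 0" "g v1 v1 = 1" "g v1 v5 = 0" "g v1 v4 = 0" "g v1 v3 = 0"
    "g v1 v2 = 0"
    by (rule gram_schmidt_step_axis[OF g, of "{v5, v4, v3, v2}" 1])
      (auto simp: v5 v4 v3 v2 s[of v5 v4] s[of v5 v3] s[of v4 v3] s[of v5 v2] s[of v4 v2] s[of v3 v2])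
  define v where
    "v i = (if i = 1 then v1 else if i = 2 then v2 else if i = 3 then v3 else if i = 4 then v4 else v5)"
    for i :: 5
  define \<alpha> where "\<alpha> = v1 $ 1 * v2 $ 2 / v5 $ 5"
  have "\<alpha> > 0" using v1(1) v2(1) v5(1) by (simp add: \<alpha>_def)
  have on: "orthonormal_frame g v"
    unfolding orthonormal_frame_def forall_5 v_def
    using v1 v2 v3 v4 v5
    by (simp add: s[of v5 v4] s[of v5 v3] s[of v4 v3] s[of v5 v2] s[of v4 v2] s[of v3 v2]
        s[of v5 v1] s[of v4 v1] s[of v3 v1] s[of v2 v1])
  have e5: "v5 = v5 $ 5 *\<^sub>R axis 5 1"
    using v5(3) by (simp add: vec_eq_iff axis_def)
  have z: "\<alpha> *\<^sub>R v5 = (v1 $ 1 * v2 $ 2) *\<^sub>R axis 5 1"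
    by (subst e5) (use v5(1) in \<open>simp add: \<alpha>_def\<close>)
  have "milnor_bracket \<alpha> v"
    unfolding milnor_bracket_def forall_5 v_def heis_bracket_def
    using v2 v3 v4 v5 by (simp add: z)
  with on \<open>\<alpha> > 0\<close> show thesis by (rule that)
qed

section \<open>Curvature in a Milnor frame\<close>

lemma heis_bracket_milnor:
  assumes g: "inner_product g" and v: "orthonormal_frame g v" and m: "milnor_bracket \<alpha> v"
  shows "heis_bracket x y = (\<alpha> * (g x (v 1) * g y (v 2) - g x (v 2) * g y (v 1))) *\<^sub>R v 5"
proof -
  have "bilinear heis_bracket" using lie_bracket_heis by (simp add: lie_bracket_def)
  from bilinear_frame_expansion[OF g v this, of x y] show ?thesis
    using m unfolding milnor_bracket_def sum_UNIV_5 by (simp add: algebra_simps)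
qed

text \<open>The solution of the Koszul formula: with \<open>x\<^sub>i = g x (v i)\<close>, its non-zero values on the frame are
  \<open>D v\<^sub>1 v\<^sub>2 = - D v\<^sub>2 v\<^sub>1 = (\<alpha>/2) v\<^sub>5\<close>,
  \<open>D v\<^sub>1 v\<^sub>5 = D v\<^sub>5 v\<^sub>1 = - (\<alpha>/2) v\<^sub>2\<close> and
  \<open>D v\<^sub>2 v\<^sub>5 = D v\<^sub>5 v\<^sub>2 = (\<alpha>/2) v\<^sub>1\<close>. It is written in coordinates, rather than on the
  frame, so that the identities below become polynomial identities in the \<open>x\<^sub>i\<close>.\<close>
definition milnor_connection ::
  "(real ^ 5 \<Rightarrow> real ^ 5 \<Rightarrow> real) \<Rightarrow> real \<Rightarrow> (5 \<Rightarrow> real ^ 5) \<Rightarrow> real ^ 5 \<Rightarrow> real ^ 5 \<Rightarrow> real ^ 5" where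
  "milnor_connection g \<alpha> v x y = (\<alpha> / 2) *\<^sub>R
     ((g x (v 2) * g y (v 5) + g x (v 5) * g y (v 2)) *\<^sub>R v 1
      - (g x (v 1) * g y (v 5) + g x (v 5) * g y (v 1)) *\<^sub>R v 2
      + (g x (v 1) * g y (v 2) - g x (v 2) * g y (v 1)) *\<^sub>R v 5)"

lemma milnor_connection_coordinates:
  assumes g: "inner_product g" and v: "orthonormal_frame g v"
  shows "g (milnor_connection g \<alpha> v x y) z = \<alpha> / 2 *
     ((g x (v 2) * g y (v 5) + g x (v 5) * g y (v 2)) * g z (v 1)
      - (g x (v 1) * g y (v 5) + g x (v 5) * g y (v 1)) * g z (v 2)
      + (g x (v 1) * g y (v 2) - g x (v 2) * g y (v 1)) * g z (v 5))"
  unfolding milnor_connection_def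
  by (simp add: bilinear_expand[OF inner_product_bilinear[OF g]] inner_product_commute[OF g, of "v _" z])

lemma bilinear_milnor_connection:
  assumes g: "inner_product g"
  shows "bilinear (milnor_connection g \<alpha> v)"
  unfolding bilinear_def milnor_connection_def
  by (auto intro!: linearI simp: bilinear_expand[OF inner_product_bilinear[OF g]] vec_eq_iff field_simps)

text \<open>By uniqueness of the Levi-Civita connection, torsion-freeness and metric compatibility suffice.\<close>
lemma levi_civita_milnor:
  assumes g: "inner_product g" and v: "orthonormal_frame g v" and m: "milnor_bracket \<alpha> v"
  shows "levi_civita heis_bracket g = milnor_connection g \<alpha> v"
  unfolding levi_civita_def
proof (rule the1_equality[OF ex1_levi_civita[OF lie_bracket_heis g]])
  have "milnor_connection g \<alpha> v x y - milnor_connection g \<alpha> v y x = heis_bracket x y" for x y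
    unfolding heis_bracket_milnor[OF g v m] milnor_connection_def
    by (simp add: vec_eq_iff field_simps)
  moreover have "g (milnor_connection g \<alpha> v x y) z + g y (milnor_connection g \<alpha> v x z) = 0" for x y z
    unfolding inner_product_commute[OF g, of y] milnor_connection_coordinates[OF g v]
    by (simp add: algebra_simps)
  ultimately show "is_levi_civita heis_bracket g (milnor_connection g \<alpha> v)"
    by (simp add: is_levi_civita_def bilinear_milnor_connection[OF g])
qed

text \<open>Taking the trace in the frame turns the curvature into a sum of five terms, each a polynomial
  in the frame coordinates of \<open>y\<close> and \<open>z\<close>.\<close>
lemma Ric_milnor:
  assumes g: "inner_product g" and v: "orthonormal_frame g v" and m: "milnor_bracket \<alpha> v"
  shows "Ric heis_bracket g y z =
    \<alpha>\<^sup>2 / 2 * (g y (v 5) * g z (v 5) - g y (v 1) * g z (v 1) - g y (v 2) * g z (v 2))"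
proof -
  note b = inner_product_bilinear[OF g]
  define D where "D = milnor_connection g \<alpha> v"
  have bD: "bilinear D" unfolding D_def by (rule bilinear_milnor_connection[OF g])
  have bH: "bilinear heis_bracket" using lie_bracket_heis by (simp add: lie_bracket_def)
  have R: "riemann_curvature heis_bracket g x y z =
      D x (D y z) - D y (D x z) - D (heis_bracket x y) z" for x
    by (simp add: riemann_curvature_def levi_civita_milnor[OF g v m] D_def Let_def)
  have e: "g (v i) (v j) = (if i = j then 1 else 0)" for i j
    using v by (simp add: orthonormal_frame_def)
  have "linear (\<lambda>x. riemann_curvature heis_bracket g x y z)"
    unfolding R
    by (rule linearI) (simp_all add: bilinear_expand[OF bD] bilinear_expand[OF bH] algebra_simps)
  then have "Ric heis_bracket g y z = (\<Sum>i\<in>UNIV. g (riemann_curvature heis_bracket g (v i) y z) (v i))"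
    unfolding Ric_def by (rule trace_orthonormal_frame[OF g v])
  also have "\<dots> = \<alpha>\<^sup>2 / 2 * (g y (v 5) * g z (v 5) - g y (v 1) * g z (v 1) - g y (v 2) * g z (v 2))"
    unfolding R D_def
    by (simp add: sum_UNIV_5 bilinear_lsub[OF b] milnor_connection_coordinates[OF g v]
        heis_bracket_milnor[OF g v m] bilinear_lmul[OF b] e)
      (simp add: field_simps power2_eq_square)
  finally show ?thesis .
qed

section \<open>Prescribing the Ricci tensor\<close>

text \<open>The scale factor \<open>\<eta>\<close> is absorbed into the inner product.\<close>
lemma milnor_basis_iff:
  "milnor_basis v \<longleftrightarrow> (\<exists>g \<alpha>. inner_product g \<and> orthonormal_frame g v \<and> \<alpha> > 0 \<and> milnor_bracket \<alpha> v)"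
proof
  assume "milnor_basis v"
  then obtain h \<eta> \<alpha> where h: "inner_product h" "\<eta> > 0"
      "\<forall>i j. \<eta> * h (v i) (v j) = (if i = j then 1 else 0)"
    and a: "\<alpha> > 0" "milnor_bracket \<alpha> v"
    unfolding milnor_basis_def milnor_bracket_def by blast
  have "bilinear (\<lambda>x y. \<eta> * h x y)"
    unfolding bilinear_def
    by (auto intro!: linearI simp: bilinear_expand[OF inner_product_bilinear[OF h(1)]] algebra_simps)
  then have "inner_product (\<lambda>x y. \<eta> * h x y)"
    using h(1,2) by (auto simp: inner_product_def symmetric_form_def)
  moreover have "orthonormal_frame (\<lambda>x y. \<eta> * h x y) v"
    using h(3) by (simp add: orthonormal_frame_def)
  ultimately show "\<exists>g \<alpha>. inner_product g \<and> orthonormal_frame g v \<and> \<alpha> > 0 \<and> milnor_bracket \<alpha> v"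
    using a by blast
next
  assume "\<exists>g \<alpha>. inner_product g \<and> orthonormal_frame g v \<and> \<alpha> > 0 \<and> milnor_bracket \<alpha> v"
  then obtain g \<alpha> where g: "inner_product g" "orthonormal_frame g v"
    and a: "\<alpha> > 0" "milnor_bracket \<alpha> v" by blast
  have "\<exists>h \<eta>. inner_product h \<and> \<eta> > 0 \<and> (\<forall>i j. \<eta> * h (v i) (v j) = (if i = j then 1 else 0))"
    using g by (intro exI[of _ g] exI[of _ 1]) (simp add: orthonormal_frame_def)
  then show "milnor_basis v"
    unfolding milnor_basis_def
    using orthonormal_frame_basis[OF g] a unfolding milnor_bracket_def by blast
qed

lemma form_matrix_eq_diag_iff:
  "form_matrix T v = diag d \<longleftrightarrow> (\<forall>i j. T (v i) (v j) = (if i = j then d $ i else 0))"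
  by (simp add: form_matrix_def diag_def vec_eq_iff)

theorem theorem5:
  fixes T :: "real ^ 5 \<Rightarrow> real ^ 5 \<Rightarrow> real"
  assumes "symmetric_form T"
  shows "(\<exists>g t. inner_product g \<and> t \<noteq> 0 \<and> (\<forall>x y. Ric heis_bracket g x y = t\<^sup>2 * T x y)) \<longleftrightarrow>
         (\<exists>v a b c. milnor_basis v \<and> form_matrix T v = diag (vector [a, b, 0, 0, c]) \<and>
                    a < 0 \<and> a = b \<and> b = - c)"
proof
  assume "\<exists>g t. inner_product g \<and> t \<noteq> 0 \<and> (\<forall>x y. Ric heis_bracket g x y = t\<^sup>2 * T x y)"
  then obtain g t where g: "inner_product g" and t: "t \<noteq> 0"
    and Ric: "\<And>x y. Ric heis_bracket g x y = t\<^sup>2 * T x y" by blast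
  obtain v \<alpha> where v: "orthonormal_frame g v" and \<alpha>: "\<alpha> > 0" and m: "milnor_bracket \<alpha> v"
    by (rule exists_orthonormal_milnor_frame[OF g])
  define c where "c = \<alpha>\<^sup>2 / (2 * t\<^sup>2)"
  have "c > 0" using \<alpha> t by (simp add: c_def)
  have "T x y = c * (g x (v 5) * g y (v 5) - g x (v 1) * g y (v 1) - g x (v 2) * g y (v 2))" for x y
    using Ric[of x y] t unfolding Ric_milnor[OF g v m] c_def by (simp add: field_simps)
  then have "form_matrix T v = diag (vector [- c, - c, 0, 0, c])"
    using v unfolding form_matrix_eq_diag_iff orthonormal_frame_def forall_5 by simp
  moreover have "milnor_basis v" using milnor_basis_iff g v \<alpha> m by blast
  ultimately show "\<exists>v a b c. milnor_basis v \<and> form_matrix T v = diag (vector [a, b, 0, 0, c]) \<and>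
      a < 0 \<and> a = b \<and> b = - c"
    using \<open>c > 0\<close> by (intro exI[of _ v] exI[of _ "- c"] exI[of _ c]) simp
next
  assume "\<exists>v a b c. milnor_basis v \<and> form_matrix T v = diag (vector [a, b, 0, 0, c]) \<and>
      a < 0 \<and> a = b \<and> b = - c"
  then obtain v c where "milnor_basis v" and d: "form_matrix T v = diag (vector [- c, - c, 0, 0, c])"
    and c: "c > 0" by auto
  then obtain g \<alpha> where g: "inner_product g" and v: "orthonormal_frame g v"
    and \<alpha>: "\<alpha> > 0" and m: "milnor_bracket \<alpha> v" using milnor_basis_iff by blast
  have "bilinear T" using assms by (simp add: symmetric_form_def)
  then have "T x y = c * (g x (v 5) * g y (v 5) - g x (v 1) * g y (v 1) - g x (v 2) * g y (v 2))" for x y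
    using d unfolding form_matrix_eq_diag_iff
    by (simp add: bilinear_frame_expansion[OF g v, of T x y] sum_UNIV_5 algebra_simps)
  \<comment> \<open>The ratio of \<open>\<alpha>\<^sup>2 / 2\<close> to \<open>c\<close> must be \<open>t\<^sup>2\<close>.\<close>
  then have "Ric heis_bracket g x y = (\<alpha> / sqrt (2 * c))\<^sup>2 * T x y" for x y
    using c by (simp add: Ric_milnor[OF g v m] power_divide)
  moreover have "\<alpha> / sqrt (2 * c) \<noteq> 0" using \<alpha> c by simp
  ultimately show "\<exists>g t. inner_product g \<and> t \<noteq> 0 \<and> (\<forall>x y. Ric heis_bracket g x y = t\<^sup>2 * T x y)"
    using g by blast
qed

end
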